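(* Let $k\geq 1$ be an integer and let $0 < p < 1$, $0 < q < 1$. Let $EL_{SR}$ and $EL_{CR}$ denote the expected length (expected total number of points played) of a Best-of-$(2k+1)$ game, with $A$ serving first, played under the Standard Rule and under the Catch-Up Rule, respectively. Then $$EL_{CR} > EL_{SR} \quad\text{if and only if}\quad p+q>1.$$
   Context: Two players $A$ and $B$ play a sequence of points. On each point exactly one player is the server, and exactly one of the two players wins the point (and scores one point). When $A$ serves, $A$ wins the point with probability $p$ (and $B$ wins it with probability $1-p$); when $B$ serves, $B$ wins the point with probability $q$ (and $A$ wins it with probability $1-q$). Here $q$ is not an abbreviation for $1-p$; $p$ and $q$ are unrelated parameters. The results of the serves are independent. $A$ always serves the first point. A Best-of-$(2k+1)$ game (Win-by-One) ends as soon as one player has scored $k+1$ points, and that player wins the game. The length of a game is the total number of points played until some player wins. Serving rules after the first point: under the Standard Rule ($SR$), the server of each subsequent point is the winner of the previous point. Under the Catch-Up Rule ($CR$), the server of each subsequent point is the loser of the previous point. *)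

theory Defs
  imports "HOL-Probability.Probability_Mass_Function"
begin

datatype player = Player_A | Player_B

datatype rule = SR | CR

fun opponent :: "player \<Rightarrow> player" where
  "opponent Player_A = Player_B"
| "opponent Player_B = Player_A"

text \<open>A history is the list of the winners of the points played so far, in chronological order.\<close>

definition score :: "player \<Rightarrow> player list \<Rightarrow> nat" where
  "score x h = count_list h x"

definition game_over :: "nat \<Rightarrow> player list \<Rightarrow> bool" where
  "game_over k h \<longleftrightarrow> (\<exists>x. score x h \<ge> k + 1)"

fun next_server :: "rule \<Rightarrow> player \<Rightarrow> player" where
  "next_server SR w = w"
| "next_server CR w = opponent w"

definition server :: "rule \<Rightarrow> player list \<Rightarrow> player" where
  "server r h = (if h = [] then Player_A else next_server r (last h))"

fun serve_prob :: "real \<Rightarrow> real \<Rightarrow> player \<Rightarrow> real" where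
  "serve_prob p q Player_A = p"
| "serve_prob p q Player_B = q"

definition point_pmf :: "real \<Rightarrow> real \<Rightarrow> player \<Rightarrow> player pmf" where
  "point_pmf p q s =
     map_pmf (\<lambda>b. if b then s else opponent s) (bernoulli_pmf (serve_prob p q s))"

lemma length_eq_scores: "length h = score Player_A h + score Player_B h"
  unfolding score_def
proof (induction h)
  case (Cons x h)
  then show ?case by (cases x) auto
qed simp

text \<open>
  The law of the complete history of the game, continued from the history \<open>h\<close>.
  Independence of the serves is expressed by the monadic bind: given the history, the next
  point depends only on who serves it.
\<close>

function play :: "nat \<Rightarrow> real \<Rightarrow> real \<Rightarrow> rule \<Rightarrow> player list \<Rightarrow> player list pmf" where
  "play k p q r h =
     (if game_over k h then return_pmf h
      else bind_pmf (point_pmf p q (server r h)) (\<lambda>w. play k p q r (h @ [w])))"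
  by pat_completeness auto
termination
proof (relation "Wellfounded.measure (\<lambda>(k, p, q, r, h). 2 * k + 1 - length h)")
  fix k :: nat and p q :: real and r :: rule and h :: "player list" and w :: player
  assume "\<not> game_over k h"
  then have "score Player_A h \<le> k" "score Player_B h \<le> k"
    by (auto simp: game_over_def not_le less_Suc_eq_le)
  then show "((k, p, q, r, h @ [w]), (k, p, q, r, h))
      \<in> Wellfounded.measure (\<lambda>(k, p, q, r, h). 2 * k + 1 - length h)"
    using length_eq_scores[of h] by simp
qed simp

declare play.simps [simp del]

definition game :: "nat \<Rightarrow> real \<Rightarrow> real \<Rightarrow> rule \<Rightarrow> player list pmf" where
  "game k p q r = play k p q r []"

definition expected_length :: "nat \<Rightarrow> real \<Rightarrow> real \<Rightarrow> rule \<Rightarrow> real" where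
  "expected_length k p q r = measure_pmf.expectation (game k p q r) (\<lambda>h. real (length h))"

end

theory Submission
  imports Defs "HOL-Analysis.Weierstrass_Theorems"
begin

text \<open>
  Forget who serves and watch only the sequence of winners. Under either rule it is a
  two-state Markov chain: with a certain probability the point goes to the player who did not
  win the previous one. Call this a switch. Under the Standard Rule the previous winner serves,
  so the switch probabilities after a point of \<open>A\<close> and of \<open>B\<close> are \<open>1 - p\<close> and \<open>1 - q\<close>. Under the
  Catch-Up Rule the previous loser serves, so they are \<open>q\<close> and \<open>p\<close>. Imagine an
  extra point before the first, won by \<open>A\<close> under the Standard Rule and by \<open>B\<close> under the Catch-Up
  Rule; it makes \<open>A\<close> serve first, and so the first point fits the same pattern. Call the winner of
  this uncounted point the starting player. The game is symmetric in the two players, hence both expected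
  lengths are values of one function \<open>F s t\<close> of the switch probabilities of the starting player and
  of the other one: \<open>F (1 - p) (1 - q)\<close> for the Standard Rule and \<open>F p q\<close> for the Catch-Up Rule
  (lemma \<open>expected_length_eq\<close>).

  To compute \<open>F\<close>, read every point as a trial of the player who won the previous point: it either
  succeeds, and this player scores, or it switches, and then the other player scores and makes the
  next trial. Give the starting player \<open>k + 1\<close> trials and the other one \<open>k\<close>. Since the switches of
  the two players alternate, a player whose turn it is has no trial left exactly when that player has
  scored \<open>k + 1\<close> points, so the length of the game is \<open>2 * k + 1\<close> minus the number of unused trials.
  Let \<open>a\<close> and \<open>b\<close> be the numbers of switches among all the trials of the two players, unused ones
  included; they are independent and binomial. If \<open>a \<le> b\<close>, the starting player wins and the unused
  trials, all of the opponent, contain \<open>b - a\<close> switches. If \<open>a > b\<close>, the opponent wins and the unused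
  trials contain \<open>a - b - 1\<close> switches. Unused trials are still independent of the course of the
  game, so Wald's identity gives their mean number, and
  \<open>F s t = 2 * k + 1 - E (b - a)\<^sup>+ / t - E (a - b - 1)\<^sup>+ / s\<close>.
  Lemma \<open>mean_points_left_eq\<close> proves this formula by checking that it satisfies the one-step
  recursion for \<open>F\<close>.

  Replacing \<open>s\<close> and \<open>t\<close> by \<open>1 - s\<close> and \<open>1 - t\<close> replaces \<open>a\<close> by \<open>k + 1 - a\<close> and \<open>b\<close> by \<open>k - b\<close>, which
  exchanges the two positive parts. Subtracting, the difference of the expected lengths becomes
  \<open>p + q - 1\<close> times a positive number (lemma \<open>mean_points_left_complement_diff\<close>).
\<close>

section \<open>Binomial averages\<close>

text \<open>
  The Bernstein polynomial \<open>Bernstein m a s\<close> is the probability of \<open>a\<close> successes in \<open>m\<close> independent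
  trials with success probability \<open>s\<close>, so this is the expectation of \<open>f\<close> under a binomial law. As a
  polynomial in \<open>s\<close> it obeys its identities without any bounds on \<open>s\<close>.
\<close>

definition binomial_mean :: "nat \<Rightarrow> real \<Rightarrow> (nat \<Rightarrow> real) \<Rightarrow> real" where
  "binomial_mean m s f = (\<Sum>a\<le>m. Bernstein m a s * f a)"

lemma binomial_mean_0 [simp]: "binomial_mean 0 s f = f 0"
  by (simp add: binomial_mean_def Bernstein_def)

lemma binomial_mean_const: "binomial_mean m s (\<lambda>_. c) = c"
  by (simp add: binomial_mean_def sum_Bernstein flip: sum_distrib_right)

lemma binomial_mean_of_nat: "binomial_mean m s real = real m * s"
  using sum_k_Bernstein[where n = m and x = s] by (simp add: binomial_mean_def mult.commute)

lemma binomial_mean_swap: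
  "binomial_mean m s (\<lambda>a. binomial_mean n t (f a)) =
   binomial_mean n t (\<lambda>b. binomial_mean m s (\<lambda>a. f a b))"
  unfolding binomial_mean_def sum_distrib_left
  by (subst sum.swap) (simp add: mult_ac)

lemma binomial_mean_complement:
  "binomial_mean m (1 - s) f = binomial_mean m s (\<lambda>a. f (m - a))"
  unfolding binomial_mean_def
  by (rule sum.reindex_bij_witness[where i = "\<lambda>a. m - a" and j = "\<lambda>a. m - a"])
     (auto simp: Bernstein_def binomial_symmetric[symmetric])

lemma binomial_mean_cong:
  "(\<And>a. a \<le> m \<Longrightarrow> f a = g a) \<Longrightarrow> binomial_mean m s f = binomial_mean m s g"
  by (simp add: binomial_mean_def)

lemma binomial_mean_nonneg:
  "0 \<le> s \<Longrightarrow> s \<le> 1 \<Longrightarrow> (\<And>a. a \<le> m \<Longrightarrow> 0 \<le> f a) \<Longrightarrow> 0 \<le> binomial_mean m s f"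
  by (auto simp: binomial_mean_def intro!: sum_nonneg mult_nonneg_nonneg Bernstein_nonneg)

lemma binomial_mean_pos:
  assumes "0 < s" "s < 1" "\<And>a. a \<le> m \<Longrightarrow> 0 \<le> f a" "c \<le> m" "0 < f c"
  shows "0 < binomial_mean m s f"
  unfolding binomial_mean_def
  using assms by (intro sum_pos2[of _ c]) (auto intro!: Bernstein_nonneg Bernstein_pos mult_pos_pos mult_nonneg_nonneg)

text \<open>Conditioning on the first of the \<open>Suc m\<close> trials.\<close>

lemma binomial_mean_Suc:
  "binomial_mean (Suc m) s f =
   s * binomial_mean m s (\<lambda>a. f (Suc a)) + (1 - s) * binomial_mean m s f"
proof -
  have Bernstein_Suc: "Bernstein (Suc m) (Suc a) s =
      s * Bernstein m a s + (1 - s) * Bernstein m (Suc a) s" if "a \<le> m" for a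
  proof (cases "a = m")
    case False
    with that have "m - a = Suc (m - Suc a)" by simp
    then show ?thesis by (simp add: Bernstein_def algebra_simps)
  qed (simp add: Bernstein_def)
  have Bernstein_Suc_0: "Bernstein (Suc m) 0 s = (1 - s) * Bernstein m 0 s"
    by (simp add: Bernstein_def)
  have "binomial_mean (Suc m) s f =
      Bernstein (Suc m) 0 s * f 0 + (\<Sum>a\<le>m. Bernstein (Suc m) (Suc a) s * f (Suc a))"
    by (simp add: binomial_mean_def sum.atMost_Suc_shift del: sum.atMost_Suc)
  also have "\<dots> = s * binomial_mean m s (\<lambda>a. f (Suc a))
      + (1 - s) * (Bernstein m 0 s * f 0 + (\<Sum>a\<le>m. Bernstein m (Suc a) s * f (Suc a)))"
    by (simp add: Bernstein_Suc Bernstein_Suc_0 binomial_mean_def distrib_right distrib_left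
        sum.distrib sum_distrib_left mult.assoc)
  also have "Bernstein m 0 s * f 0 + (\<Sum>a\<le>m. Bernstein m (Suc a) s * f (Suc a)) =
      (\<Sum>a\<le>Suc m. Bernstein m a s * f a)"
    by (simp add: sum.atMost_Suc_shift del: sum.atMost_Suc)
  also have "\<dots> = binomial_mean m s f"
    by (simp add: binomial_mean_def Bernstein_def)
  finally show ?thesis .
qed

section \<open>The game as a chain of winners\<close>

text \<open>
  The expected number of points still to be played when the player who won the last point needs
  \<open>m\<close> more points and the other one needs \<open>n + 1\<close>; their switch probabilities are \<open>s\<close> and \<open>t\<close>. With
  the shift by one, \<open>m\<close> and \<open>n\<close> are also the numbers of trials left to the two players, so that a
  trial decreases \<open>m\<close> and leaves \<open>n\<close> unchanged whatever its result, and a switch merely exchanges the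
  roles. A game that is over always has \<open>m = 0\<close>, because the last point was won by the winner of
  the game.
\<close>

function mean_points_left :: "real \<Rightarrow> real \<Rightarrow> nat \<Rightarrow> nat \<Rightarrow> real" where
  "mean_points_left s t 0 n = 0"
| "mean_points_left s t (Suc m) n =
     1 + (1 - s) * mean_points_left s t m n + s * mean_points_left t s n m"
  by pat_completeness auto
termination by (relation "Wellfounded.measure (\<lambda>(s, t, m, n). m + n)") auto

text \<open>
  Before the first point the value is the player who, as winner of an imaginary earlier point,
  would give the first serve to \<open>A\<close>.
\<close>

definition last_winner :: "rule \<Rightarrow> player list \<Rightarrow> player" where
  "last_winner r h =
     (if h = [] then (case r of SR \<Rightarrow> Player_A | CR \<Rightarrow> Player_B) else last h)"

definition switch_prob :: "real \<Rightarrow> real \<Rightarrow> rule \<Rightarrow> player \<Rightarrow> real" where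
  "switch_prob p q r w =
     (case r of SR \<Rightarrow> 1 - serve_prob p q w | CR \<Rightarrow> serve_prob p q (opponent w))"

lemma opponent_opponent [simp]: "opponent (opponent w) = w"
  by (cases w) auto

lemma opponent_neq [simp]: "opponent w \<noteq> w"
  by (cases w) auto

lemma score_snoc: "score x (h @ [w]) = score x h + (if x = w then 1 else 0)"
  by (simp add: score_def)

lemma game_over_iff:
  "game_over k h \<longleftrightarrow> k < score w h \<or> k < score (opponent w) h"
proof -
  have "(\<exists>x. P x) \<longleftrightarrow> P w \<or> P (opponent w)" for P
    by (metis opponent.elims player.exhaust opponent.simps)
  then show ?thesis by (simp add: game_over_def Suc_le_eq)
qed

lemma finite_set_pmf_play: "finite (set_pmf (play k p q r h))"
proof (induction k p q r h rule: play.induct)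
  case (1 k p q r h)
  have "finite (set_pmf (point_pmf p q (server r h)))"
    by (rule finite_subset[of _ "{Player_A, Player_B}"]) (use player.exhaust in auto)
  with 1 show ?case
    by (subst play.simps) auto
qed

lemma set_pmf_point:
  assumes "0 < p" "p < 1" "0 < q" "q < 1"
  shows "x \<in> set_pmf (point_pmf p q s)"
  using assms by (cases s; cases x) (auto simp: point_pmf_def set_pmf_bernoulli UNIV_bool)

lemma expectation_play_step:
  fixes r :: rule
  assumes "\<not> game_over k h" "0 < p" "p < 1" "0 < q" "q < 1"
  defines "w \<equiv> last_winner r h"
  shows "measure_pmf.expectation (play k p q r h) f =
    (1 - switch_prob p q r w) * measure_pmf.expectation (play k p q r (h @ [w])) f +
    switch_prob p q r w * measure_pmf.expectation (play k p q r (h @ [opponent w])) f"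
proof -
  define v where "v = server r h"
  have prob: "0 \<le> serve_prob p q v" "serve_prob p q v \<le> 1"
    using assms by (cases v; simp)+
  have "measure_pmf.expectation (play k p q r h) f = measure_pmf.expectation
      (bind_pmf (bernoulli_pmf (serve_prob p q v))
        (\<lambda>b. play k p q r (h @ [if b then v else opponent v]))) f"
    unfolding v_def using assms(1) by (subst play.simps) (simp add: point_pmf_def bind_map_pmf)
  also have "\<dots> = serve_prob p q v * measure_pmf.expectation (play k p q r (h @ [v])) f +
      (1 - serve_prob p q v) * measure_pmf.expectation (play k p q r (h @ [opponent v])) f"
    by (subst pmf_expectation_bind[where A = UNIV])
       (use prob in \<open>auto simp: UNIV_bool finite_set_pmf_play\<close>)
  also have "v = next_server r w"
    by (simp add: v_def w_def server_def last_winner_def split: rule.split)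
  finally show ?thesis
    by (cases r) (simp_all add: switch_prob_def)
qed

text \<open>
  The score bounds exclude histories that were continued after the end of the game: the player
  who did not win the last point has not yet scored \<open>k + 1\<close> points, and so the game is over exactly
  when the last winner has.
\<close>

lemma expectation_play:
  assumes "0 < p" "p < 1" "0 < q" "q < 1"
    and "score (last_winner r h) h \<le> Suc k" "score (opponent (last_winner r h)) h \<le> k"
  shows "measure_pmf.expectation (play k p q r h) (\<lambda>h. real (length h)) =
    real (length h) +
    mean_points_left (switch_prob p q r (last_winner r h))
      (switch_prob p q r (opponent (last_winner r h)))
      (Suc k - score (last_winner r h) h) (k - score (opponent (last_winner r h)) h)"
  using assms
proof (induction k p q r h rule: play.induct)
  case (1 k p q r h)
  define w where "w = last_winner r h"
  note score_le = "1.prems"(5,6)[folded w_def]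
  show ?case
  proof (cases "game_over k h")
    case True
    then have "Suc k - score w h = 0"
      using score_le by (auto simp: game_over_iff[of _ _ w])
    with True show ?thesis
      by (subst play.simps) (simp flip: w_def)
  next
    case False
    then have le: "score w h \<le> k" "score (opponent w) h \<le> k"
      by (auto simp: game_over_iff[of _ _ w])
    have last: "last_winner r (h @ [x]) = x" for x
      by (simp add: last_winner_def)
    have IH: "measure_pmf.expectation (play k p q r (h @ [x])) (\<lambda>h. real (length h)) =
        real (length h) + 1 + mean_points_left (switch_prob p q r x)
          (switch_prob p q r (opponent x)) (k - score x h) (k - score (opponent x) h)"
      if "x = w \<or> x = opponent w" for x
      using "1.IH"[OF False set_pmf_point, of x] "1.prems"(1-4) le that
      by (auto simp: last score_snoc)
    have "Suc k - score w h = Suc (k - score w h)"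
      using le by simp
    then show ?thesis
      using expectation_play_step[OF False "1.prems"(1-4), of r "\<lambda>h. real (length h)"]
        IH[of w] IH[of "opponent w"]
      by (simp add: algebra_simps flip: w_def)
  qed
qed

text \<open>
  Under the Catch-Up Rule the imaginary last winner is \<open>B\<close>, after whose points \<open>A\<close> serves and
  a switch means that \<open>A\<close> wins the point; this is why \<open>p\<close> comes first there as well.
\<close>

lemma expected_length_eq:
  assumes "0 < p" "p < 1" "0 < q" "q < 1"
  shows "expected_length k p q SR = mean_points_left (1 - p) (1 - q) (Suc k) k"
    and "expected_length k p q CR = mean_points_left p q (Suc k) k"
  using expectation_play[OF assms, where h = "[]" and k = k]
  by (simp_all add: expected_length_def game_def last_winner_def score_def switch_prob_def
      del: mean_points_left.simps)

section \<open>Counting the unused trials\<close>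

text \<open>
  Truncated subtraction on the naturals supplies the positive parts. In the recursion, a switch
  in the first trial turns \<open>a\<close> into \<open>Suc a\<close>; since \<open>b - Suc a\<close> and \<open>Suc a - Suc b = a - b\<close> are the two
  quantities with the players exchanged, the formula reproduces itself.
\<close>

lemma mean_points_left_eq:
  assumes "s \<noteq> 0" "t \<noteq> 0"
  shows "mean_points_left s t m n = real m + real n
    - binomial_mean m s (\<lambda>a. binomial_mean n t (\<lambda>b. real (b - a))) / t
    - binomial_mean m s (\<lambda>a. binomial_mean n t (\<lambda>b. real (a - Suc b))) / s"
  using assms
proof (induction s t m n rule: mean_points_left.induct)
  case (1 s t n)
  then show ?case
    by (simp add: binomial_mean_of_nat binomial_mean_const)
next
  case (2 s t m n)
  let ?M = "\<lambda>f. binomial_mean m s (\<lambda>a. binomial_mean n t (f a))"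
  have "mean_points_left s t (Suc m) n =
      1 + (1 - s) * (real m + real n - ?M (\<lambda>a b. real (b - a)) / t
            - ?M (\<lambda>a b. real (a - Suc b)) / s)
        + s * (real m + real n - ?M (\<lambda>a b. real (a - b)) / s
            - ?M (\<lambda>a b. real (b - Suc a)) / t)"
    using "2.IH" "2.prems" by (simp add: binomial_mean_swap[of n t m s])
  also have "\<dots> = real (Suc m) + real n
      - (s * ?M (\<lambda>a b. real (b - Suc a)) + (1 - s) * ?M (\<lambda>a b. real (b - a))) / t
      - (s * ?M (\<lambda>a b. real (a - b)) + (1 - s) * ?M (\<lambda>a b. real (a - Suc b))) / s"
    using "2.prems" by (simp add: field_simps)
  finally show ?case
    by (simp only: binomial_mean_Suc diff_Suc_Suc)
qed

text \<open>
  With \<open>Suc k\<close> trials against \<open>k\<close>, passing to the complementary numbers of switches exchanges the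
  two positive parts, and each of them occurs with \<open>1 / (1 - s) - 1 / t\<close> or \<open>1 / (1 - t) - 1 / s\<close>
  as its coefficient. Both coefficients contain the factor \<open>s + t - 1\<close>.
\<close>

lemma mean_points_left_complement_diff:
  assumes "0 < s" "s < 1" "0 < t" "t < 1"
  shows "mean_points_left s t (Suc k) k - mean_points_left (1 - s) (1 - t) (Suc k) k =
    (s + t - 1) *
      (binomial_mean (Suc k) s (\<lambda>a. binomial_mean k t (\<lambda>b. real (b - a))) / (t * (1 - s)) +
       binomial_mean (Suc k) s (\<lambda>a. binomial_mean k t (\<lambda>b. real (a - Suc b))) / (s * (1 - t)))"
proof -
  let ?M = "\<lambda>f. binomial_mean (Suc k) s (\<lambda>a. binomial_mean k t (f a))"
  let ?M' = "\<lambda>f. binomial_mean (Suc k) (1 - s) (\<lambda>a. binomial_mean k (1 - t) (f a))"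
  have "?M' (\<lambda>a b. real (b - a)) = ?M (\<lambda>a b. real (a - Suc b))"
    "?M' (\<lambda>a b. real (a - Suc b)) = ?M (\<lambda>a b. real (b - a))"
    unfolding binomial_mean_complement
    by (intro binomial_mean_cong arg_cong[of _ _ real]; simp)+
  then have "mean_points_left (1 - s) (1 - t) (Suc k) k = real (Suc k) + real k
      - ?M (\<lambda>a b. real (a - Suc b)) / (1 - t) - ?M (\<lambda>a b. real (b - a)) / (1 - s)"
    using assms by (simp add: mean_points_left_eq del: mean_points_left.simps)
  moreover have "mean_points_left s t (Suc k) k = real (Suc k) + real k
      - ?M (\<lambda>a b. real (b - a)) / t - ?M (\<lambda>a b. real (a - Suc b)) / s"
    using assms by (subst mean_points_left_eq) auto
  moreover have coefficient: "x / (1 - s) - x / t = (s + t - 1) * (x / (t * (1 - s)))"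
    "x / (1 - t) - x / s = (s + t - 1) * (x / (s * (1 - t)))" for x
    using assms by (simp_all add: divide_simps) (simp_all add: algebra_simps)
  ultimately show ?thesis
    unfolding distrib_left coefficient[symmetric] by linarith
qed

theorem theorem2:
  fixes k :: nat and p q :: real
  assumes "k \<ge> 1" and "0 < p" and "p < 1" and "0 < q" and "q < 1"
  shows "expected_length k p q CR > expected_length k p q SR \<longleftrightarrow> p + q > 1"
proof -
  let ?M = "\<lambda>f. binomial_mean (Suc k) p (\<lambda>a. binomial_mean k q (f a))"
  define c where "c = ?M (\<lambda>a b. real (b - a)) / (q * (1 - p)) +
    ?M (\<lambda>a b. real (a - Suc b)) / (p * (1 - q))"
  \<comment> \<open>The outcome \<open>a = 0\<close>, \<open>b = 1\<close> makes this mean strictly positive; it exists because \<open>k \<ge> 1\<close>.\<close>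
  have "0 < ?M (\<lambda>a b. real (b - a))"
    using assms
    by (intro binomial_mean_pos[where c = 0] binomial_mean_pos[where c = 1] binomial_mean_nonneg)
       auto
  moreover have "0 \<le> ?M (\<lambda>a b. real (a - Suc b))"
    using assms by (intro binomial_mean_nonneg) auto
  ultimately have "0 < c"
    unfolding c_def using assms by (intro add_pos_nonneg divide_pos_pos divide_nonneg_pos) auto
  have "expected_length k p q CR - expected_length k p q SR = (p + q - 1) * c"
    using assms expected_length_eq[of p q k] mean_points_left_complement_diff[of p q k]
    by (simp add: c_def del: mean_points_left.simps)
  with \<open>0 < c\<close> show ?thesis
    by (smt (verit) zero_less_mult_iff)
qed

end
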